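(* Let $\omega=e^{\pi i/3}$ and $\Gamma=\langle A,B\rangle\subset\mathrm{PSL}_2(\mathbb{Z}[\omega])$ with $A=\begin{pmatrix}1&1\\0&1\end{pmatrix}$, $B=\begin{pmatrix}1&0\\ 1+\omega&1\end{pmatrix}$. If $X,Y\in\Gamma$ satisfy $\Gamma=\langle X,Y\rangle$ and $\mathrm{tr}\,X=\mathrm{tr}\,Y$, then $X$ and $Y$ are parabolic.
   Context: $\Gamma$ is the image of the discrete faithful representation of the fundamental group of the complement of the two-component two-bridge link $6^2_2$ in $S^3$, so $\mathbb{H}^3/\Gamma\cong S^3\smallsetminus 6^2_2$; it is a finite-covolume Kleinian group with traces in $\mathbb{Z}[\omega]$, the ring of integers of its trace field $\mathbb{Q}(\omega)$. Traces are taken of lifts to $\mathrm{SL}_2\mathbb{C}$; "$\mathrm{tr}\,X=\mathrm{tr}\,Y$" means the elements admit lifts of equal trace. Parabolic means non-identity with $\mathrm{tr}^2=4$. *)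

theory Defs
  imports "HOL-Analysis.Analysis"
begin

text \<open>2x2 complex matrices (SL_2 lifts). Rows/columns indexed by type 2;
  index 1 is the first row/column, the other index the second.\<close>

type_synonym cmat2 = "complex^2^2"

definition mat2 :: "complex \<Rightarrow> complex \<Rightarrow> complex \<Rightarrow> complex \<Rightarrow> cmat2" where
  "mat2 a b c d = (\<chi> i j. if i = 1 then (if j = 1 then a else b) else (if j = 1 then c else d))"

inductive_set gen_group :: "cmat2 set \<Rightarrow> cmat2 set" for S where
  one: "mat 1 \<in> gen_group S"
| mul: "M \<in> gen_group S \<Longrightarrow> s \<in> S \<Longrightarrow> M ** s \<in> gen_group S"
| mul_inv: "M \<in> gen_group S \<Longrightarrow> s \<in> S \<Longrightarrow> M ** matrix_inv s \<in> gen_group S"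

definition omega :: complex where "omega = cis (pi / 3)"

definition matA :: cmat2 where "matA = mat2 1 1 0 1"
definition matB :: cmat2 where "matB = mat2 1 0 (1 + omega) 1"

text \<open>Preimage of Gamma = <A,B> in SL_2: generated by A, B and -I.\<close>
definition Gamma_lift :: "cmat2 set" where
  "Gamma_lift = gen_group {matA, matB, - mat 1}"

text \<open>Parabolic element of PSL_2 (given by a lift): non-identity with trace^2 = 4.\<close>
definition parabolic :: "cmat2 \<Rightarrow> bool" where
  "parabolic X \<longleftrightarrow> X \<noteq> mat 1 \<and> X \<noteq> - mat 1 \<and> (trace X)^2 = 4"

end

theory Submission
  imports Defs
begin

text \<open>
  Put \<open>p = 1 + \<omega>\<close>, a prime above 3. Modulo \<open>p\<close> the group consists, up to sign, of upper
  unitriangular matrices, so after changing signs \<open>x = tr X = tr Y\<close> and \<open>z = tr XY\<close> are both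
  congruent to 2. Since the span of \<open>1, X, Y, XY\<close> over the Eisenstein integers is closed under
  multiplication, it contains \<open>A\<close> and \<open>B\<close>, whence \<open>det (XY - YX) = - (z - 2)(z + 2 - x\<^sup>2)\<close>
  divides \<open>det (AB - BA) = - p\<^sup>2\<close>. Both factors are multiples of \<open>p\<close>, so \<open>z - 2 = p u\<close> and
  \<open>z + 2 - x\<^sup>2 = p v\<close> with units \<open>u, v\<close>. Writing \<open>x = 2 + p t\<close> gives \<open>t (4 + p t) = u - v\<close>, of
  absolute value at most 2, which leaves only \<open>x = 2\<close> and \<open>x = - 1\<close>. Modulo 2 the group is
  dihedral of order 10 and has no element of trace 1, which excludes the latter.
\<close>

section \<open>Eisenstein integers\<close>

definition eis :: "complex set" where
  "eis = {of_int m + of_int n * omega | m n :: int. True}"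

lemma omega_Re: "Re omega = 1 / 2" and omega_Im: "Im omega = sqrt 3 / 2"
  by (simp_all add: omega_def cos_60 sin_60)

lemma omega_square: "omega\<^sup>2 = omega - 1"
  by (simp add: complex_eq_iff omega_Re omega_Im power2_eq_square)

lemma omega_mult_omega: "omega * omega = omega - 1"
  using omega_square by (simp add: power2_eq_square)

lemma eis_coord_eq_iff:
  "of_int m + of_int n * omega = of_int k + of_int l * omega \<longleftrightarrow> m = k \<and> n = l"
  by (auto simp: complex_eq_iff omega_Re omega_Im)

lemma eisI: "z = of_int m + of_int n * omega \<Longrightarrow> z \<in> eis"
  by (auto simp: eis_def)

lemma eisE:
  assumes "z \<in> eis"
  obtains m n :: int where "z = of_int m + of_int n * omega"
  using assms by (auto simp: eis_def)

lemma eis_of_int [simp]: "of_int m \<in> eis"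
  by (rule eisI[of _ m 0]) simp

lemma eis_0 [simp]: "0 \<in> eis" and eis_1 [simp]: "1 \<in> eis" and eis_numeral [simp]: "numeral k \<in> eis"
  using eis_of_int[of 0] eis_of_int[of 1] eis_of_int[of "numeral k"] by simp_all

lemma eis_omega [simp]: "omega \<in> eis"
  by (rule eisI[of _ 0 1]) simp

lemma eis_add [simp]: "a \<in> eis \<Longrightarrow> b \<in> eis \<Longrightarrow> a + b \<in> eis"
proof (elim eisE)
  fix m n k l :: int
  assume "a = of_int m + of_int n * omega" "b = of_int k + of_int l * omega"
  then show "a + b \<in> eis"
    by (intro eisI[of _ "m + k" "n + l"]) (simp add: algebra_simps)
qed

lemma eis_uminus [simp]: "a \<in> eis \<Longrightarrow> - a \<in> eis"
proof (elim eisE)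
  fix m n :: int
  assume "a = of_int m + of_int n * omega"
  then show "- a \<in> eis"
    by (intro eisI[of _ "- m" "- n"]) simp
qed

lemma eis_diff [simp]: "a \<in> eis \<Longrightarrow> b \<in> eis \<Longrightarrow> a - b \<in> eis"
  using eis_add[of a "- b"] by simp

lemma eis_coord_mult:
  "(of_int m + of_int n * omega) * (of_int k + of_int l * omega) =
    of_int (m * k - n * l) + of_int (m * l + n * k + n * l) * omega"
proof -
  have "(of_int m + of_int n * omega) * (of_int k + of_int l * omega) =
    of_int m * of_int k + (of_int m * of_int l + of_int n * of_int k) * omega
      + of_int n * of_int l * (omega * omega)"
    by (simp add: algebra_simps)
  then show ?thesis
    by (simp add: omega_mult_omega algebra_simps)
qed

lemma eis_mult [simp]: "a \<in> eis \<Longrightarrow> b \<in> eis \<Longrightarrow> a * b \<in> eis"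
  by (elim eisE) (simp only: eis_coord_mult, rule eisI, rule refl)

lemma eis_power [simp]: "a \<in> eis \<Longrightarrow> a ^ n \<in> eis"
  by (induction n) auto

lemma cmod_eis_coord:
  "(cmod (of_int m + of_int n * omega))\<^sup>2 = of_int (m\<^sup>2 + m * n + n\<^sup>2)"
  by (simp only: cmod_power2) (simp add: omega_Re omega_Im power2_eq_square field_simps)

text \<open>The squared modulus is a value of an integral quadratic form, so it is a positive
  integer once it is nonzero.\<close>

lemma cmod_eis_ge_1:
  assumes "z \<in> eis" "z \<noteq> 0"
  shows "cmod z \<ge> 1"
proof -
  obtain m n :: int where z: "z = of_int m + of_int n * omega"
    using assms(1) by (rule eisE)
  have "(cmod z)\<^sup>2 > 0"
    using assms(2) by simp
  then have "m\<^sup>2 + m * n + n\<^sup>2 > 0"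
    unfolding z cmod_eis_coord by linarith
  then have "(cmod z)\<^sup>2 \<ge> 1"
    unfolding z cmod_eis_coord by linarith
  then show ?thesis
    by (simp add: power2_nonneg_ge_1_iff)
qed

lemma cmod_eis_unit:
  assumes "u \<in> eis" "v \<in> eis" "u * v = 1"
  shows "cmod u = 1"
proof -
  have "u \<noteq> 0" "v \<noteq> 0"
    using assms(3) by auto
  then have "cmod u \<ge> 1" "cmod v \<ge> 1"
    using assms cmod_eis_ge_1 by auto
  moreover have "cmod u * cmod v = 1"
    by (metis assms(3) norm_mult norm_one)
  ultimately show ?thesis
    by (smt (verit) mult_less_cancel_left2)
qed

text \<open>The square of this element is 3 up to a unit.\<close>

definition rt3 :: complex where "rt3 = 1 + omega"

lemma eis_rt3 [simp]: "rt3 \<in> eis"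
  by (simp add: rt3_def)

lemma rt3_nonzero: "rt3 \<noteq> 0"
  by (simp add: rt3_def complex_eq_iff omega_Re)

text \<open>Comparing coordinates gives \<open>4 = m - n\<close> and \<open>m = - 2 * n\<close>,
  hence \<open>4 = - 3 * n\<close>. This is what separates a trace congruent to 2 from its
  negative.\<close>

lemma four_not_multiple_rt3:
  assumes "k \<in> eis"
  shows "4 \<noteq> rt3 * k"
proof
  assume eq: "4 = rt3 * k"
  obtain m n :: int where k: "k = of_int m + of_int n * omega"
    using assms by (rule eisE)
  have "of_int 4 + of_int 0 * omega = (of_int 1 + of_int 1 * omega) * (of_int m + of_int n * omega)"
    using eq unfolding k rt3_def by simp
  then have "4 = m - n \<and> 0 = m + 2 * n"
    unfolding eis_coord_mult eis_coord_eq_iff by auto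
  then show False
    by presburger
qed

text \<open>Completing the square bounds \<open>n\<close>; the form is symmetric, so the same bound
  applies to \<open>m\<close>.\<close>

lemma eis_norm_le_4:
  fixes m n :: int
  assumes "m\<^sup>2 + m * n + n\<^sup>2 \<le> 4"
  shows "\<bar>n\<bar> < 3"
proof -
  have "3 * n\<^sup>2 \<le> (2 * m + n)\<^sup>2 + 3 * n\<^sup>2"
    by simp
  also have "\<dots> = 4 * (m\<^sup>2 + m * n + n\<^sup>2)"
    by (simp add: power2_eq_square algebra_simps)
  also have "\<dots> \<le> 4 * 4"
    using assms by (intro mult_left_mono) auto
  finally have "n\<^sup>2 < 3\<^sup>2"
    by simp
  then show ?thesis
    using power2_less_imp_less[of "\<bar>n\<bar>" 3] by simp
qed

text \<open>The factor \<open>4 + rt3 * t\<close> is nonzero, so its norm is at least 1 and the norm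
  of \<open>t\<close> is at most 4. Only finitely many lattice points remain to be checked.\<close>

lemma trace_bound_solutions:
  assumes "t \<in> eis" "cmod (t * (4 + rt3 * t)) \<le> 2"
  shows "t = 0 \<or> 2 + rt3 * t = - 1"
proof (rule disjCI)
  assume "2 + rt3 * t \<noteq> - 1"
  obtain m n :: int where t: "t = of_int m + of_int n * omega"
    using assms(1) by (rule eisE)
  have rt: "rt3 * t = of_int (m - n) + of_int (m + 2 * n) * omega"
    unfolding t rt3_def using eis_coord_mult[of 1 1 m n] by (simp add: algebra_simps)
  define a where "a = m - n"
  define b where "b = m + 2 * n"
  have 4: "4 + rt3 * t = of_int (4 + a) + of_int b * omega"
    unfolding rt a_def b_def by simp
  \<comment> \<open>The excluded point is minus the conjugate of \<open>rt3\<close>, for which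
    \<open>rt3 * t = - 3\<close>.\<close>
  have ne: "\<not> (m = - 2 \<and> n = 1)"
    using \<open>2 + rt3 * t \<noteq> - 1\<close> unfolding rt by auto
  have "(cmod t)\<^sup>2 * (cmod (4 + rt3 * t))\<^sup>2 \<le> 2\<^sup>2"
    using power_mono[OF assms(2), of 2] by (simp add: norm_mult power_mult_distrib)
  then have "real_of_int ((m\<^sup>2 + m * n + n\<^sup>2) * ((4 + a)\<^sup>2 + (4 + a) * b + b\<^sup>2)) \<le> real_of_int 4"
    unfolding 4 unfolding t cmod_eis_coord by simp
  then have le: "(m\<^sup>2 + m * n + n\<^sup>2) * ((4 + a)\<^sup>2 + (4 + a) * b + b\<^sup>2) \<le> 4"
    by (simp only: of_int_le_iff)
  have "4 + rt3 * t \<noteq> 0"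
    using four_not_multiple_rt3[of "- t"] assms(1) by (auto simp: add_eq_0_iff2)
  then have "(cmod (4 + rt3 * t))\<^sup>2 > 0"
    by simp
  then have pos: "(4 + a)\<^sup>2 + (4 + a) * b + b\<^sup>2 > 0"
    unfolding 4 cmod_eis_coord by linarith
  have "4 * (m\<^sup>2 + m * n + n\<^sup>2) = (2 * m + n)\<^sup>2 + 3 * n\<^sup>2"
    by (simp add: power2_eq_square algebra_simps)
  also have "\<dots> \<ge> 0"
    by simp
  finally have "m\<^sup>2 + m * n + n\<^sup>2 \<ge> 0"
    by (simp only: zero_le_mult_iff) auto
  then have "(m\<^sup>2 + m * n + n\<^sup>2) * 1 \<le> (m\<^sup>2 + m * n + n\<^sup>2) * ((4 + a)\<^sup>2 + (4 + a) * b + b\<^sup>2)"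
    using pos by (intro mult_left_mono) auto
  from order_trans[OF this le] have "m\<^sup>2 + m * n + n\<^sup>2 \<le> 4"
    by (simp only: mult_1_right)
  then have "\<bar>m\<bar> < 3" "\<bar>n\<bar> < 3"
    using eis_norm_le_4[of m n] eis_norm_le_4[of n m] by (simp_all add: algebra_simps)
  then have "m \<in> {-2, -1, 0, 1, 2}" "n \<in> {-2, -1, 0, 1, 2}"
    by auto
  then have "m = 0 \<and> n = 0"
    using le ne unfolding a_def b_def by auto
  then show "t = 0"
    by (simp add: t)
qed

section \<open>Two-by-two matrices\<close>

lemma cmat2_eq_iff:
  "(M :: cmat2) = N \<longleftrightarrow> M$1$1 = N$1$1 \<and> M$1$2 = N$1$2 \<and> M$2$1 = N$2$1 \<and> M$2$2 = N$2$2"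
  by (auto simp: vec_eq_iff forall_2)

lemma mat2_nth [simp]:
  "mat2 a b c d $ 1 $ 1 = a" "mat2 a b c d $ 1 $ 2 = b"
  "mat2 a b c d $ 2 $ 1 = c" "mat2 a b c d $ 2 $ 2 = d"
  by (simp_all add: mat2_def)

lemma mult_nth2: "((M :: cmat2) ** N) $ i $ j = M$i$1 * N$1$j + M$i$2 * N$2$j"
  by (simp add: matrix_matrix_mult_def sum_2)

lemma mat_nth2 [simp]:
  "(mat a :: cmat2) $ 1 $ 1 = a" "(mat a :: cmat2) $ 1 $ 2 = 0"
  "(mat a :: cmat2) $ 2 $ 1 = 0" "(mat a :: cmat2) $ 2 $ 2 = a"
  by (simp_all add: mat_def)

lemma trace_nth2: "trace (M :: cmat2) = M$1$1 + M$2$2"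
  by (simp add: trace_def sum_2)

text \<open>The adjugate. It is polynomial in the entries, so integrality and congruences pass to
  inverses of matrices of determinant 1.\<close>

definition adj2 :: "cmat2 \<Rightarrow> cmat2" where
  "adj2 M = mat2 (M$2$2) (- M$1$2) (- M$2$1) (M$1$1)"

lemma matrix_inv_eq_adj2:
  assumes "det (M :: cmat2) = 1"
  shows "matrix_inv M = adj2 M"
  unfolding matrix_inv_def
proof (rule some_equality)
  show inv: "M ** adj2 M = mat 1 \<and> adj2 M ** M = mat 1"
    using assms by (auto simp: cmat2_eq_iff mult_nth2 adj2_def det_2 algebra_simps)
  fix N
  assume "M ** N = mat 1 \<and> N ** M = mat 1"
  then show "N = adj2 M"
    by (metis inv matrix_mul_assoc matrix_mul_lid matrix_mul_rid)
qed

lemma det_adj2: "det (adj2 M) = det M"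
  by (simp add: det_2 adj2_def algebra_simps)

lemma det_uminus2: "det (- M :: cmat2) = det M"
  by (simp add: det_2)

lemma mult_uminus_left: "(- M :: cmat2) ** N = - (M ** N)"
  and mult_uminus_right: "M ** (- N :: cmat2) = - (M ** N)"
  by (simp_all add: cmat2_eq_iff mult_nth2)

lemma trace_uminus: "trace (- M :: cmat2) = - trace M"
  by (simp add: trace_nth2)

lemma adj2_neg_mat_1: "adj2 (- mat 1) = - mat 1"
  by (simp add: cmat2_eq_iff adj2_def)

lemma Cayley_Hamilton2: "(X :: cmat2) ** X = mat (trace X) ** X - mat (det X)"
  by (simp add: cmat2_eq_iff mult_nth2 trace_nth2 det_2 algebra_simps)

text \<open>The part of Cayley-Hamilton for \<open>X + Y\<close> that is bilinear in
  \<open>X\<close> and \<open>Y\<close>, solved for \<open>Y ** X\<close>.\<close>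

lemma Cayley_Hamilton2_polarized:
  "(Y :: cmat2) ** X = mat (trace X) ** Y + mat (trace Y) ** X
     + mat (trace (X ** Y) - trace X * trace Y) - X ** Y"
  by (simp add: cmat2_eq_iff mult_nth2 trace_nth2 algebra_simps)

text \<open>For invertible \<open>Y\<close> this is Cayley-Hamilton for \<open>X ** Y\<close>,
  multiplied on the right by the inverse of \<open>Y\<close>.\<close>

lemma mult_XYX:
  "(X :: cmat2) ** Y ** X = mat (trace (X ** Y)) ** X + mat (det X) ** Y - mat (det X * trace Y)"
  by (simp add: cmat2_eq_iff mult_nth2 trace_nth2 det_2 algebra_simps)

lemma mult_XYY:
  "(X :: cmat2) ** Y ** Y = mat (trace Y) ** (X ** Y) - mat (det Y) ** X"
  by (simp add: cmat2_eq_iff mult_nth2 trace_nth2 det_2 algebra_simps)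

text \<open>The determinant of the commutator in the associative algebra plays the role of
  the discriminant of the order spanned by 1, X, Y, XY.\<close>

lemma det_commutator:
  "det (X ** Y - Y ** X :: cmat2) = 4 * det X * det Y - (trace X)\<^sup>2 * det Y - (trace Y)\<^sup>2 * det X
     - (trace (X ** Y))\<^sup>2 + trace X * trace Y * trace (X ** Y)"
  by (simp add: mult_nth2 trace_nth2 det_2 power2_eq_square algebra_simps)

section \<open>The order spanned by 1, X, Y and XY\<close>

definition lin4 :: "cmat2 \<Rightarrow> cmat2 \<Rightarrow> complex \<Rightarrow> complex \<Rightarrow> complex \<Rightarrow> complex \<Rightarrow> cmat2" where
  "lin4 X Y a b c d = mat a + mat b ** X + mat c ** Y + mat d ** (X ** Y)"

text \<open>With C the commutator of \<open>X\<close> and \<open>Y\<close>, bilinearity leaves C,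
  [X, XY] = X C and [XY, Y] = C Y. The last equals \<open>adj2 Y\<close> times C, because C and C Y
  have trace 0. So every commutator in the span is a left multiple of C.\<close>

lemma commutator_lin4:
  "lin4 X Y a b c d ** lin4 X Y a' b' c' d' - lin4 X Y a' b' c' d' ** lin4 X Y a b c d =
    (mat (b * c' - c * b') + mat (b * d' - d * b') ** X + mat (d * c' - c * d') ** adj2 Y)
      ** (X ** Y - Y ** X)"
  by (simp add: lin4_def cmat2_eq_iff mult_nth2 adj2_def algebra_simps)

definition eis_span :: "cmat2 \<Rightarrow> cmat2 \<Rightarrow> cmat2 set" where
  "eis_span X Y = {lin4 X Y a b c d | a b c d. a \<in> eis \<and> b \<in> eis \<and> c \<in> eis \<and> d \<in> eis}"

lemma eis_spanI:
  "M = lin4 X Y a b c d \<Longrightarrow> a \<in> eis \<Longrightarrow> b \<in> eis \<Longrightarrow> c \<in> eis \<Longrightarrow> d \<in> eis \<Longrightarrow> M \<in> eis_span X Y"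
  by (auto simp: eis_span_def)

lemma eis_spanE:
  assumes "M \<in> eis_span X Y"
  obtains a b c d where "M = lin4 X Y a b c d" "a \<in> eis" "b \<in> eis" "c \<in> eis" "d \<in> eis"
  using assms by (auto simp: eis_span_def)

lemma eis_span_one: "mat 1 \<in> eis_span X Y"
  by (rule eis_spanI[of _ _ _ 1 0 0 0]) (simp_all add: lin4_def cmat2_eq_iff mult_nth2)

text \<open>Multiplication by an adjugate takes this shape, with \<open>k\<close> a trace;
  \<open>k = 0\<close> gives negation.\<close>

lemma eis_span_scale_diff:
  assumes "M \<in> eis_span X Y" "N \<in> eis_span X Y" "k \<in> eis"
  shows "mat k ** M - N \<in> eis_span X Y"
proof -
  obtain a b c d where M: "M = lin4 X Y a b c d" "a \<in> eis" "b \<in> eis" "c \<in> eis" "d \<in> eis"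
    using assms(1) by (rule eis_spanE)
  obtain a' b' c' d' where N: "N = lin4 X Y a' b' c' d'" "a' \<in> eis" "b' \<in> eis" "c' \<in> eis" "d' \<in> eis"
    using assms(2) by (rule eis_spanE)
  show ?thesis
    by (rule eis_spanI[of _ _ _ "k * a - a'" "k * b - b'" "k * c - c'" "k * d - d'"])
      (use M N assms(3) in \<open>simp_all add: lin4_def cmat2_eq_iff mult_nth2 algebra_simps\<close>)
qed

lemma eis_span_uminus:
  assumes "M \<in> eis_span X Y"
  shows "- M \<in> eis_span X Y"
proof -
  have "mat 0 ** M - M = - M"
    by (simp add: cmat2_eq_iff mult_nth2)
  then show ?thesis
    using eis_span_scale_diff[OF assms assms eis_0] by simp
qed

text \<open>The products \<open>X ** X\<close>, \<open>Y ** X\<close> and \<open>X ** Y ** X\<close>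
  reduce to the spanning elements by the identities above, with coefficients that are polynomials in
  the three traces.\<close>

lemma eis_span_mult_left_gen:
  assumes "M \<in> eis_span X Y" "det X = 1"
    and tr: "trace X \<in> eis" "trace Y \<in> eis" "trace (X ** Y) \<in> eis"
  shows "M ** X \<in> eis_span X Y"
proof -
  obtain a b c d where M: "M = lin4 X Y a b c d" "a \<in> eis" "b \<in> eis" "c \<in> eis" "d \<in> eis"
    using assms(1) by (rule eis_spanE)
  let ?x = "trace X" and ?y = "trace Y" and ?z = "trace (X ** Y)"
  have "M ** X = mat a ** X + mat b ** (X ** X) + mat c ** (Y ** X) + mat d ** (X ** Y ** X)"
    by (simp add: M(1) lin4_def cmat2_eq_iff mult_nth2 algebra_simps)
  also have "\<dots> = lin4 X Y (c * (?z - ?x * ?y) - b - d * ?y) (a + b * ?x + c * ?y + d * ?z) (c * ?x + d) (- c)"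
    unfolding Cayley_Hamilton2[of X] Cayley_Hamilton2_polarized[of Y X] mult_XYX[of X Y] assms(2) lin4_def
    by (simp add: cmat2_eq_iff mult_nth2 algebra_simps)
  finally show ?thesis
    by (rule eis_spanI) (use M tr in simp_all)
qed

lemma eis_span_mult_right_gen:
  assumes "M \<in> eis_span X Y" "det Y = 1" and tr: "trace Y \<in> eis"
  shows "M ** Y \<in> eis_span X Y"
proof -
  obtain a b c d where M: "M = lin4 X Y a b c d" "a \<in> eis" "b \<in> eis" "c \<in> eis" "d \<in> eis"
    using assms(1) by (rule eis_spanE)
  have "M ** Y = mat a ** Y + mat b ** (X ** Y) + mat c ** (Y ** Y) + mat d ** (X ** Y ** Y)"
    by (simp add: M(1) lin4_def cmat2_eq_iff mult_nth2 algebra_simps)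
  also have "\<dots> = lin4 X Y (- c) (- d) (a + c * trace Y) (b + d * trace Y)"
    unfolding Cayley_Hamilton2[of Y] mult_XYY[of X Y] assms(2) lin4_def
    by (simp add: cmat2_eq_iff mult_nth2 algebra_simps)
  finally show ?thesis
    by (rule eis_spanI) (use M tr in simp_all)
qed

lemma gen_group_subset_eis_span:
  assumes "det X = 1" "det Y = 1"
    and tr: "trace X \<in> eis" "trace Y \<in> eis" "trace (X ** Y) \<in> eis"
  shows "gen_group {X, Y, - mat 1} \<subseteq> eis_span X Y"
proof
  \<comment> \<open>Since \<open>adj2 N\<close> is \<open>mat (trace N) - N\<close>, closure under
    inverses of generators follows from closure under the generators.\<close>
  have adj: "M ** adj2 N = mat (trace N) ** M - M ** N" for M N :: cmat2
    by (simp add: cmat2_eq_iff adj2_def mult_nth2 trace_nth2 algebra_simps)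
  have gen: "M ** s \<in> eis_span X Y" if "M \<in> eis_span X Y" "s \<in> {X, Y, - mat 1}" for M s
    using that assms eis_span_mult_left_gen eis_span_mult_right_gen eis_span_uminus
    by (auto simp: mult_uminus_right)
  have det: "det s = 1" and trs: "trace s \<in> eis" if "s \<in> {X, Y, - mat 1}" for s
    using that assms by (auto simp: det_uminus2 trace_nth2)
  fix M
  assume "M \<in> gen_group {X, Y, - mat 1}"
  then show "M \<in> eis_span X Y"
  proof induction
    case one
    show ?case by (rule eis_span_one)
  next
    case (mul M s)
    then show ?case using gen by blast
  next
    case (mul_inv M s)
    then show ?case
      using gen[of M s] eis_span_scale_diff trs det by (simp only: matrix_inv_eq_adj2 adj)
  qed
qed

section \<open>Congruence conditions on the group\<close>

definition unip3 :: "cmat2 set" where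
  "unip3 = {M. det M = 1 \<and> M$1$2 \<in> eis \<and> (\<exists>k\<in>eis. M$1$1 = 1 + rt3 * k) \<and>
     (\<exists>k\<in>eis. M$2$2 = 1 + rt3 * k) \<and> (\<exists>k\<in>eis. M$2$1 = rt3 * k)}"

lemma unip3I:
  assumes "det M = 1" "M$1$2 \<in> eis" "M$1$1 = 1 + rt3 * k" "M$2$2 = 1 + rt3 * l" "M$2$1 = rt3 * m"
    "k \<in> eis" "l \<in> eis" "m \<in> eis"
  shows "M \<in> unip3"
  using assms by (auto simp: unip3_def)

lemma unip3E:
  assumes "M \<in> unip3"
  obtains k l m where "det M = 1" "M$1$2 \<in> eis" "M$1$1 = 1 + rt3 * k" "M$2$2 = 1 + rt3 * l"
    "M$2$1 = rt3 * m" "k \<in> eis" "l \<in> eis" "m \<in> eis"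
  using assms by (auto simp: unip3_def)

lemma unip3_mult:
  assumes "M \<in> unip3" "N \<in> unip3"
  shows "M ** N \<in> unip3"
proof -
  obtain k l m where M: "det M = 1" "M$1$2 \<in> eis" "M$1$1 = 1 + rt3 * k" "M$2$2 = 1 + rt3 * l"
    "M$2$1 = rt3 * m" "k \<in> eis" "l \<in> eis" "m \<in> eis"
    using assms(1) by (rule unip3E)
  obtain k' l' m' where N: "det N = 1" "N$1$2 \<in> eis" "N$1$1 = 1 + rt3 * k'" "N$2$2 = 1 + rt3 * l'"
    "N$2$1 = rt3 * m'" "k' \<in> eis" "l' \<in> eis" "m' \<in> eis"
    using assms(2) by (rule unip3E)
  show ?thesis
  proof (rule unip3I)
    show "det (M ** N) = 1"
      using M N by (simp add: det_mul)
    show "(M ** N)$1$2 \<in> eis"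
      using M N by (simp add: mult_nth2)
    show "(M ** N)$1$1 = 1 + rt3 * (k + k' + rt3 * k * k' + M$1$2 * m')"
      using M N by (simp add: mult_nth2 algebra_simps)
    show "(M ** N)$2$2 = 1 + rt3 * (l + l' + rt3 * l * l' + m * N$1$2)"
      using M N by (simp add: mult_nth2 algebra_simps)
    show "(M ** N)$2$1 = rt3 * (m * (1 + rt3 * k') + (1 + rt3 * l) * m')"
      using M N by (simp add: mult_nth2 algebra_simps)
  qed (use M N in simp_all)
qed

lemma unip3_adj2:
  assumes "M \<in> unip3"
  shows "adj2 M \<in> unip3"
proof -
  obtain k l m where M: "det M = 1" "M$1$2 \<in> eis" "M$1$1 = 1 + rt3 * k" "M$2$2 = 1 + rt3 * l"
    "M$2$1 = rt3 * m" "k \<in> eis" "l \<in> eis" "m \<in> eis"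
    using assms by (rule unip3E)
  show ?thesis
    by (rule unip3I[of _ l k "- m"]) (use M in \<open>simp_all add: det_adj2, simp_all add: adj2_def\<close>)
qed

lemma trace_unip3:
  assumes "M \<in> unip3"
  obtains t where "t \<in> eis" "trace M = 2 + rt3 * t"
proof -
  obtain k l m where "M$1$1 = 1 + rt3 * k" "M$2$2 = 1 + rt3 * l" "k \<in> eis" "l \<in> eis"
    using assms by (rule unip3E)
  then show ?thesis
    by (intro that[of "k + l"]) (simp_all add: trace_nth2 algebra_simps)
qed

lemma matA_unip3: "matA \<in> unip3"
  by (rule unip3I[of _ 0 0 0]) (simp_all add: matA_def det_2)

lemma matB_unip3: "matB \<in> unip3"
  by (rule unip3I[of _ 0 0 1]) (simp_all add: matB_def rt3_def det_2)

text \<open>Both \<open>matA\<close> and \<open>matB\<close> lie in the group \<open>unip3\<close>,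
  and the remaining generator only flips the sign.\<close>

lemma Gamma_lift_unip3:
  assumes "M \<in> Gamma_lift"
  shows "M \<in> unip3 \<or> - M \<in> unip3"
  using assms unfolding Gamma_lift_def
proof induction
  case one
  have "mat 1 \<in> unip3"
    by (rule unip3I[of _ 0 0 0]) simp_all
  then show ?case ..
next
  case (mul M s)
  then consider "s \<in> unip3" | "s = - mat 1"
    using matA_unip3 matB_unip3 by blast
  then show ?case
  proof cases
    case 1
    then have "M ** s \<in> unip3 \<or> (- M) ** s \<in> unip3"
      using mul.IH unip3_mult by blast
    then show ?thesis by (simp add: mult_uminus_left)
  next
    case 2
    then show ?thesis using mul.IH by (auto simp: mult_uminus_right)
  qed
next
  case (mul_inv M s)
  then consider "s \<in> unip3" | "s = - mat 1"
    using matA_unip3 matB_unip3 by blast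
  then show ?case
  proof cases
    case 1
    then have "matrix_inv s \<in> unip3"
      using unip3_adj2 by (simp add: unip3_def matrix_inv_eq_adj2)
    then have "M ** matrix_inv s \<in> unip3 \<or> (- M) ** matrix_inv s \<in> unip3"
      using mul_inv.IH unip3_mult by blast
    then show ?thesis by (simp add: mult_uminus_left)
  next
    case 2
    then have "matrix_inv s = - mat 1"
      by (simp add: matrix_inv_eq_adj2 det_uminus2 adj2_neg_mat_1)
    then show ?thesis using mul_inv.IH by (auto simp: mult_uminus_right)
  qed
qed

section \<open>Reduction modulo 2\<close>

text \<open>Modulo 2 the generators become involutions whose product has order 5. The dihedral group
  they generate in \<open>SL\<^sub>2\<close> of the field with four elements is the orthogonal group of the quadratic form
  \<open>p x\<^sup>2 + p x y + y\<^sup>2\<close> with \<open>p = 1 + \<omega>\<close>; it has no element of order 3.\<close>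

definition orth2 :: "cmat2 set" where
  "orth2 = {M. det M = 1 \<and> (\<forall>i j. M$i$j \<in> eis) \<and>
     (\<exists>k\<in>eis. rt3 * (M$1$1)\<^sup>2 + rt3 * M$1$1 * M$2$1 + (M$2$1)\<^sup>2 = rt3 + 2 * k) \<and>
     (\<exists>k\<in>eis. rt3 * (M$1$2)\<^sup>2 + rt3 * M$1$2 * M$2$2 + (M$2$2)\<^sup>2 = 1 + 2 * k)}"

lemma orth2I:
  assumes "det M = 1" "M$1$1 \<in> eis" "M$1$2 \<in> eis" "M$2$1 \<in> eis" "M$2$2 \<in> eis"
    "rt3 * (M$1$1)\<^sup>2 + rt3 * M$1$1 * M$2$1 + (M$2$1)\<^sup>2 = rt3 + 2 * k"
    "rt3 * (M$1$2)\<^sup>2 + rt3 * M$1$2 * M$2$2 + (M$2$2)\<^sup>2 = 1 + 2 * l" "k \<in> eis" "l \<in> eis"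
  shows "M \<in> orth2"
  using assms by (auto simp: orth2_def forall_2)

lemma orth2E:
  assumes "M \<in> orth2"
  obtains k l where "det M = 1" "M$1$1 \<in> eis" "M$1$2 \<in> eis" "M$2$1 \<in> eis" "M$2$2 \<in> eis"
    "rt3 * (M$1$1)\<^sup>2 + rt3 * M$1$1 * M$2$1 + (M$2$1)\<^sup>2 = rt3 + 2 * k"
    "rt3 * (M$1$2)\<^sup>2 + rt3 * M$1$2 * M$2$2 + (M$2$2)\<^sup>2 = 1 + 2 * l" "k \<in> eis" "l \<in> eis"
  using assms by (auto simp: orth2_def)

lemma orth2_uminus:
  assumes "M \<in> orth2"
  shows "- M \<in> orth2"
  using assms by (auto simp: orth2_def det_uminus2)

text \<open>Let Q be the form above, and v, w the columns of \<open>M\<close>, so that Q(v) is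
  \<open>rt3\<close> and Q(w) is 1 modulo 2. Each generator adds a multiple of one column to the
  other. The polar form of v and w is congruent to \<open>rt3 * det M\<close> modulo 2, so
  determinant 1 already controls the cross term.\<close>

lemma orth2_generators:
  assumes "M \<in> orth2"
  shows "M ** matA \<in> orth2" "M ** adj2 matA \<in> orth2" "M ** matB \<in> orth2" "M ** adj2 matB \<in> orth2"
proof -
  obtain a b c d where M: "M = mat2 a b c d"
    by (metis cmat2_eq_iff mat2_nth)
  obtain k l where det: "det M = 1" and R: "a \<in> eis" "b \<in> eis" "c \<in> eis" "d \<in> eis" "k \<in> eis" "l \<in> eis"
    and k: "rt3 * a\<^sup>2 + rt3 * a * c + c\<^sup>2 = rt3 + 2 * k"
    and l: "rt3 * b\<^sup>2 + rt3 * b * d + d\<^sup>2 = 1 + 2 * l"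
    using assms by (rule orth2E) (use M in auto)
  have D: "a * d = 1 + b * c"
    using det by (simp add: M det_2 algebra_simps)
  have "det (mat2 a (a + b) c (c + d)) = 1"
    using D by (simp add: det_2 algebra_simps)
  \<comment> \<open>The witness collects half of what is even in Q(v) + Q(w) plus the polar form,
    after \<open>a * d\<close> is replaced by \<open>1 + b * c\<close>. The other three witnesses
    arise likewise.\<close>
  moreover have "rt3 * (a + b)\<^sup>2 + rt3 * (a + b) * (c + d) + (c + d)\<^sup>2
      = 1 + 2 * (k + l + rt3 + rt3 * a * b + rt3 * b * c + c * d)"
    using k l D by algebra
  ultimately have "mat2 a (a + b) c (c + d) \<in> orth2"
    by (intro orth2I[of _ "k" "k + l + rt3 + rt3 * a * b + rt3 * b * c + c * d"]) (use R k l in simp_all)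
  moreover have "M ** matA = mat2 a (a + b) c (c + d)"
    by (simp add: M matA_def cmat2_eq_iff mult_nth2)
  ultimately show "M ** matA \<in> orth2"
    by simp
  have "det (mat2 a (b - a) c (d - c)) = 1"
    using D by (simp add: det_2 algebra_simps)
  moreover have "rt3 * (b - a)\<^sup>2 + rt3 * (b - a) * (d - c) + (d - c)\<^sup>2
      = 1 + 2 * (k + l - rt3 * a * b - rt3 * b * c - c * d)"
    using k l D by algebra
  ultimately have "mat2 a (b - a) c (d - c) \<in> orth2"
    by (intro orth2I[of _ "k" "k + l - rt3 * a * b - rt3 * b * c - c * d"]) (use R k l in simp_all)
  moreover have "M ** adj2 matA = mat2 a (b - a) c (d - c)"
    by (simp add: M matA_def adj2_def cmat2_eq_iff mult_nth2)
  ultimately show "M ** adj2 matA \<in> orth2"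
    by simp
  have "det (mat2 (a + rt3 * b) b (c + rt3 * d) d) = 1"
    using D by (simp add: det_2 algebra_simps)
  moreover have "rt3 * (a + rt3 * b)\<^sup>2 + rt3 * (a + rt3 * b) * (c + rt3 * d) + (c + rt3 * d)\<^sup>2
      = rt3 + 2 * (k + rt3\<^sup>2 * (l + 1 + b * c + a * b) + rt3 * c * d)"
    using k l D by algebra
  ultimately have "mat2 (a + rt3 * b) b (c + rt3 * d) d \<in> orth2"
    by (intro orth2I[of _ "k + rt3\<^sup>2 * (l + 1 + b * c + a * b) + rt3 * c * d" "l"]) (use R k l in simp_all)
  moreover have "M ** matB = mat2 (a + rt3 * b) b (c + rt3 * d) d"
    by (simp add: M matB_def rt3_def cmat2_eq_iff mult_nth2)
  ultimately show "M ** matB \<in> orth2"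
    by simp
  have "det (mat2 (a - rt3 * b) b (c - rt3 * d) d) = 1"
    using D by (simp add: det_2 algebra_simps)
  moreover have "rt3 * (a - rt3 * b)\<^sup>2 + rt3 * (a - rt3 * b) * (c - rt3 * d) + (c - rt3 * d)\<^sup>2
      = rt3 + 2 * (k + rt3\<^sup>2 * (l - b * c - a * b) - rt3 * c * d)"
    using k l D by algebra
  ultimately have "mat2 (a - rt3 * b) b (c - rt3 * d) d \<in> orth2"
    by (intro orth2I[of _ "k + rt3\<^sup>2 * (l - b * c - a * b) - rt3 * c * d" "l"]) (use R k l in simp_all)
  moreover have "M ** adj2 matB = mat2 (a - rt3 * b) b (c - rt3 * d) d"
    by (simp add: M matB_def rt3_def adj2_def cmat2_eq_iff mult_nth2 algebra_simps)
  ultimately show "M ** adj2 matB \<in> orth2"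
    by simp
qed

lemma Gamma_lift_orth2: "Gamma_lift \<subseteq> orth2"
proof
  have gen: "matrix_inv s = adj2 s" if "s \<in> {matA, matB, - mat 1}" for s
    using that by (intro matrix_inv_eq_adj2) (auto simp: matA_def matB_def det_2)
  fix M
  assume "M \<in> Gamma_lift"
  then show "M \<in> orth2"
    unfolding Gamma_lift_def
  proof induction
    case one
    show ?case
      by (rule orth2I[of _ 0 0]) simp_all
  next
    case (mul M s)
    then show ?case
      using orth2_generators[of M] orth2_uminus[of M] by (auto simp: mult_uminus_right)
  next
    case (mul_inv M s)
    then show ?case
      using orth2_generators[of M] orth2_uminus[of M] gen[of s]
      by (auto simp: mult_uminus_right adj2_neg_mat_1)
  qed
qed

text \<open>By Cayley-Hamilton such a matrix would have order 3, also modulo 2, where its trace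
  differs from that of the identity.\<close>

lemma trace_orth2:
  assumes "M \<in> orth2"
  shows "trace M \<noteq> - 1"
proof
  assume tr: "trace M = - 1"
  obtain a b c d where M: "M = mat2 a b c d"
    by (metis cmat2_eq_iff mat2_nth)
  obtain k l where det: "det M = 1" and R: "a \<in> eis" "b \<in> eis" "c \<in> eis" "d \<in> eis" "k \<in> eis" "l \<in> eis"
    and k: "rt3 * a\<^sup>2 + rt3 * a * c + c\<^sup>2 = rt3 + 2 * k"
    and l: "rt3 * b\<^sup>2 + rt3 * b * d + d\<^sup>2 = 1 + 2 * l"
    using assms by (rule orth2E) (use M in auto)
  have "d = - 1 - a"
    using tr by (simp add: M trace_nth2 eq_diff_eq add.commute)
  have D: "a * d - b * c = 1"
    using det by (simp add: M det_2)
  obtain a1 a2 where a: "a = of_int a1 + of_int a2 * omega" using R(1) by (rule eisE)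
  obtain b1 b2 where b: "b = of_int b1 + of_int b2 * omega" using R(2) by (rule eisE)
  obtain c1 c2 where c: "c = of_int c1 + of_int c2 * omega" using R(3) by (rule eisE)
  obtain k1 k2 where k': "k = of_int k1 + of_int k2 * omega" using R(5) by (rule eisE)
  obtain l1 l2 where l': "l = of_int l1 + of_int l2 * omega" using R(6) by (rule eisE)
  have d: "d = of_int (- 1 - a1) + of_int (- a2) * omega"
    unfolding \<open>d = - 1 - a\<close> a by simp
  have add: "(of_int m + of_int n * omega) + (of_int m' + of_int n' * omega)
      = of_int (m + m') + of_int (n + n') * omega"
    and diff: "(of_int m + of_int n * omega) - (of_int m' + of_int n' * omega)
      = of_int (m - m') + of_int (n - n') * omega" for m n m' n'
    by (simp_all add: algebra_simps)
  have r: "rt3 = of_int 1 + of_int 1 * omega"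
    by (simp add: rt3_def)
  note coords = eis_coord_mult add diff eis_coord_eq_iff
  have "a * d - b * c = of_int 1 + of_int 0 * omega"
    using D by simp
  note D' = this[unfolded a b c d coords]
  have "rt3 * (a * a) + rt3 * (a * c) + c * c = rt3 + (of_int 2 + of_int 0 * omega) * k"
    using k by (simp add: power2_eq_square mult.assoc)
  note k' = this[unfolded a c k' r coords]
  have "rt3 * (b * b) + rt3 * (b * d) + d * d
      = (of_int 1 + of_int 0 * omega) + (of_int 2 + of_int 0 * omega) * l"
    using l by (simp add: power2_eq_square mult.assoc)
  note l' = this[unfolded b d l' r coords]
  \<comment> \<open>All six coordinate equations are read modulo 2. There \<open>k\<close> and
    \<open>l\<close> drop out, and a propositional contradiction in the parities of the coordinates
    of \<open>a\<close>, \<open>b\<close>, \<open>c\<close> remains.\<close>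
  show False
    using D'[THEN conjunct1, THEN arg_cong[of _ _ even]] D'[THEN conjunct2, THEN arg_cong[of _ _ even]]
      k'[THEN conjunct1, THEN arg_cong[of _ _ even]] k'[THEN conjunct2, THEN arg_cong[of _ _ even]]
      l'[THEN conjunct1, THEN arg_cong[of _ _ even]] l'[THEN conjunct2, THEN arg_cong[of _ _ even]]
    by (simp only: even_add even_diff even_minus even_mult_iff odd_one even_zero even_numeral simp_thms)
      argo
qed

section \<open>Generating pairs of equal trace\<close>

theorem theorem1p3:
  assumes "X \<in> Gamma_lift" and "Y \<in> Gamma_lift"
    and "gen_group {X, Y, - mat 1} = Gamma_lift"
    and "trace X = trace Y \<or> trace X = - trace Y"
  shows "parabolic X \<and> parabolic Y"
proof -
  define C where "C = X ** Y - Y ** X"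
  obtain X' where X': "X' \<in> unip3" "X' = X \<or> X' = - X"
    using Gamma_lift_unip3[OF assms(1)] by blast
  obtain Y' where Y': "Y' \<in> unip3" "Y' = Y \<or> Y' = - Y"
    using Gamma_lift_unip3[OF assms(2)] by blast
  have "X \<in> orth2" "Y \<in> orth2"
    using assms(1,2) Gamma_lift_orth2 by auto
  then have R: "X$i$j \<in> eis" "Y$i$j \<in> eis" and det: "det X = 1" "det Y = 1" for i j
    by (auto simp: orth2_def)
  have det': "det X' = 1" "det Y' = 1"
    using X'(2) Y'(2) det by (auto simp: det_uminus2)
  have "gen_group {X, Y, - mat 1} \<subseteq> eis_span X Y"
    using det R by (intro gen_group_subset_eis_span) (simp_all add: trace_nth2 mult_nth2)
  moreover have "matA \<in> Gamma_lift" "matB \<in> Gamma_lift"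
    unfolding Gamma_lift_def
    using gen_group.mul[OF gen_group.one, of matA "{matA, matB, - mat 1}"]
      gen_group.mul[OF gen_group.one, of matB "{matA, matB, - mat 1}"] by simp_all
  ultimately have "matA \<in> eis_span X Y" "matB \<in> eis_span X Y"
    using assms(3) by auto
  then obtain a b c d a' b' c' d' where
    A: "matA = lin4 X Y a b c d" "a \<in> eis" "b \<in> eis" "c \<in> eis" "d \<in> eis" and
    B: "matB = lin4 X Y a' b' c' d'" "a' \<in> eis" "b' \<in> eis" "c' \<in> eis" "d' \<in> eis"
    by (elim eis_spanE)
  define N where "N = mat (b * c' - c * b') + mat (b * d' - d * b') ** X + mat (d * c' - c * d') ** adj2 Y"
  have "det (matA ** matB - matB ** matA) = det N * det C"
    unfolding A(1) B(1) commutator_lin4 N_def C_def by (rule det_mul)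
  \<comment> \<open>This commutator is \<open>rt3\<close> times the diagonal matrix with entries 1
    and -1.\<close>
  moreover have "det (matA ** matB - matB ** matA) = - rt3\<^sup>2"
    by (simp add: det_2 mult_nth2 matA_def matB_def rt3_def power2_eq_square algebra_simps)
  moreover have "det N \<in> eis"
    using A B R by (simp add: N_def det_2 mult_nth2 adj2_def)
  ultimately obtain q where q: "q \<in> eis" "q * det C = - rt3\<^sup>2"
    by metis
  \<comment> \<open>Changing signs of the generators changes C at most by a sign, so its determinant
    can be computed from \<open>X'\<close> and \<open>Y'\<close>.\<close>
  have "X' ** Y' - Y' ** X' = C \<or> X' ** Y' - Y' ** X' = - C"
    using X'(2) Y'(2) by (auto simp: C_def mult_uminus_left mult_uminus_right)
  then have detC: "det (X' ** Y' - Y' ** X') = det C"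
    by (auto simp: det_uminus2)
  obtain t where t: "t \<in> eis" "trace X' = 2 + rt3 * t"
    using trace_unip3[OF X'(1)] by blast
  obtain t' where t': "t' \<in> eis" "trace Y' = 2 + rt3 * t'"
    using trace_unip3[OF Y'(1)] by blast
  obtain u where u: "u \<in> eis" "trace (X' ** Y') = 2 + rt3 * u"
    using trace_unip3[OF unip3_mult[OF X'(1) Y'(1)]] by blast
  have "trace X' = trace Y' \<or> trace X' = - trace Y'"
    using assms(4) X'(2) Y'(2) by (auto simp: trace_uminus)
  \<comment> \<open>Both traces are 2 modulo \<open>rt3\<close>; opposite traces would make 4 a
    multiple of \<open>rt3\<close>. Equality up to sign thus becomes equality.\<close>
  moreover have "trace X' \<noteq> - trace Y'"
  proof
    assume "trace X' = - trace Y'"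
    then have "4 = rt3 * (- t - t')"
      unfolding t t' by algebra
    then show False
      using four_not_multiple_rt3[of "- t - t'"] t t' by simp
  qed
  ultimately have trY: "trace Y' = 2 + rt3 * t"
    using t by simp
  \<comment> \<open>Chosen so that \<open>rt3 * v\<close> is \<open>trace (X' ** Y') + 2\<close>
    minus the square of \<open>trace X'\<close>.\<close>
  define v where "v = u - t * (4 + rt3 * t)"
  have v: "v \<in> eis"
    using t u by (simp add: v_def)
  have "det C = - (rt3 * u) * (rt3 * v)"
    unfolding detC[symmetric] det_commutator det' trY t(2) u(2) v_def by algebra
  then have "rt3\<^sup>2 * (q * u * v) = rt3\<^sup>2 * 1"
    using q(2) by (simp add: power2_eq_square algebra_simps)
  then have quv: "q * u * v = 1"
    using rt3_nonzero by (metis mult_cancel_left power_not_zero)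
  have "u * (q * v) = 1" "v * (q * u) = 1"
    using quv by (simp_all add: algebra_simps)
  then have "cmod u = 1" "cmod v = 1"
    using cmod_eis_unit q(1) u(1) v by (meson eis_mult)+
  moreover have "t * (4 + rt3 * t) = u - v"
    by (simp add: v_def)
  ultimately have "cmod (t * (4 + rt3 * t)) \<le> 2"
    using norm_triangle_ineq4[of u v] by simp
  moreover have "X' \<in> orth2"
    using X'(2) \<open>X \<in> orth2\<close> orth2_uminus by blast
  \<comment> \<open>The other solution gives \<open>X'\<close> trace -1, which is impossible in
    \<open>orth2\<close>.\<close>
  ultimately have "t = 0"
    using trace_bound_solutions[OF t(1)] trace_orth2 t(2) by metis
  then have "trace X' = 2" "trace Y' = 2"
    using t trY by simp_all
  then have "(trace X)\<^sup>2 = 4" "(trace Y)\<^sup>2 = 4"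
    using X'(2) Y'(2) by (auto simp: trace_uminus power2_eq_square minus_equation_iff[of "trace _"])
  \<comment> \<open>Plus or minus the identity commutes with everything, so a nonzero commutator
    rules it out for both generators.\<close>
  moreover have "C \<noteq> 0"
    using q(2) rt3_nonzero by (auto simp: det_2)
  then have "X \<notin> {mat 1, - mat 1}" "Y \<notin> {mat 1, - mat 1}"
    by (auto simp: C_def mult_uminus_left mult_uminus_right)
  ultimately show ?thesis
    by (simp add: parabolic_def)
qed

end
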